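(* For every fixed integer $r\ge2$, $$I_r(x)\sim\frac{3}{2\pi^2}(\log x)^2\qquad(x\to\infty).$$ Consequently, $\mathcal{H}_r^+$ has natural density zero.
   Context: The Durfee square of a partition $\lambda$ is the largest square contained in its Ferrers diagram (anchored at the top-left corner); $\operatorname{Dur}(\lambda)$ denotes its side length, i.e. the largest $d$ such that $\lambda$ has at least $d$ parts that are $\ge d$. For an integer $r\ge2$, $H_r(n):=\#\{\lambda\vdash n:\operatorname{Dur}(\lambda)\ge r\}$ is the number of partitions of $n$ whose Durfee square has side at least $r$. The positive range is $\mathcal{H}_r^+:=\{H_r(n):n\ge r^2\}$, and for real $x$, $I_r(x):=\#\{m\in\mathcal{H}_r^+:m\le x\}$. A set $A$ of positive integers has natural density zero if $\#\{m\in A: m\le x\}/x\to0$ as $x\to\infty$. $\log$ is the natural logarithm. *)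

theory Defs
  imports Complex_Main "HOL-Library.Multiset" "HOL-Library.Landau_Symbols"
begin

text \<open>A partition is the multiset of its parts, which are positive integers.\<close>

definition partitions :: "nat \<Rightarrow> nat multiset set" where
  "partitions n = {p. 0 \<notin># p \<and> sum_mset p = n}"

text \<open>The square of side \<open>d\<close> fits in the top-left corner of the Ferrers diagram iff at least
  \<open>d\<close> parts are \<open>\<ge> d\<close>. This holds for \<open>d = 0\<close> and forces \<open>d \<le> size p\<close>, so the greatest such
  \<open>d\<close> exists.\<close>

definition Dur :: "nat multiset \<Rightarrow> nat" where
  "Dur p = (GREATEST d. d \<le> size {#k \<in># p. d \<le> k#})"

definition H :: "nat \<Rightarrow> nat \<Rightarrow> nat" where
  "H r n = card {p \<in> partitions n. r \<le> Dur p}"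

definition H_pos_range :: "nat \<Rightarrow> nat set" where
  "H_pos_range r = {H r n | n. n \<ge> r ^ 2}"

definition count_upto :: "nat set \<Rightarrow> real \<Rightarrow> nat" where
  "count_upto A x = card {m \<in> A. real m \<le> x}"

definition I :: "nat \<Rightarrow> real \<Rightarrow> nat" where
  "I r x = count_upto (H_pos_range r) x"

definition natural_density_zero :: "nat set \<Rightarrow> bool" where
  "natural_density_zero A \<longleftrightarrow> ((\<lambda>x. real (count_upto A x) / x) \<longlongrightarrow> 0) at_top"

end

theory Submission
  imports Defs "HOL-Analysis.Gamma_Function" "HOL-Real_Asymp.Real_Asymp"
begin

text \<open>Adding \<open>r\<close> parts equal to \<open>r\<close> gives \<open>p (n - r\<^sup>2) \<le> H r n \<le> p n\<close> for the partition function \<open>p\<close>,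
  so \<open>ln (H r n) \<sim> ln (p n) \<sim> \<pi> \<surd>(2 n / 3)\<close>. The latter is the weak Hardy-Ramanujan asymptotics:
  expanding the logarithm of the Euler product shows that the generating function of \<open>p\<close> at
  \<open>exp (- t)\<close> is \<open>exp ((\<pi>\<^sup>2 / 6 + o(1)) / t)\<close>, and a Tauberian argument using the monotonicity of \<open>p\<close>
  concludes. Adding a part 1 shows that \<open>H r\<close> is strictly increasing from \<open>r\<^sup>2\<close> on. Hence
  \<open>I r x\<close> counts the \<open>n\<close> with \<open>H r n \<le> x\<close>, that is, essentially \<open>n \<le> 3 (ln x)\<^sup>2 / (2 \<pi>\<^sup>2)\<close>.\<close>

section \<open>Partitions and Durfee squares\<close>

lemma finite_partitions: "finite (partitions n)"
proof (rule finite_subset)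
  show "partitions n \<subseteq> mset ` {xs. set xs \<subseteq> {..n} \<and> length xs \<le> n}"
  proof
    fix p assume p: "p \<in> partitions n"
    obtain xs where xs: "p = mset xs" by (metis ex_mset)
    have nz: "0 \<notin> set xs" and s: "sum_list xs = n"
      using p by (auto simp: partitions_def xs sum_mset_sum_list)
    have "length xs \<le> sum_list xs"
      using nz by (induction xs) auto
    moreover have "x \<le> n" if "x \<in> set xs" for x
      using that s member_le_sum_list[of x xs] by simp
    ultimately show "p \<in> mset ` {xs. set xs \<subseteq> {..n} \<and> length xs \<le> n}"
      using s by (auto simp: xs)
  qed
  show "finite (mset ` {xs. set xs \<subseteq> {..n} \<and> length xs \<le> n})"
    by (intro finite_imageI finite_lists_length_le) simp
qed

lemma add_mset_partitions:
  assumes "k > 0" "p \<in> partitions n"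
  shows "add_mset k p \<in> partitions (n + k)"
  using assms by (auto simp: partitions_def)

lemma partitions_nonempty: "partitions n \<noteq> {}"
proof -
  have "replicate_mset n 1 \<in> partitions n"
    by (auto simp: partitions_def)
  then show ?thesis by blast
qed

lemma card_partitions_mono: "m \<le> n \<Longrightarrow> card (partitions m) \<le> card (partitions n)"
proof (induction n rule: dec_induct)
  case (step n)
  have "add_mset 1 ` partitions n \<subseteq> partitions (Suc n)"
    using add_mset_partitions[of 1 _ n] by auto
  then have "card (add_mset 1 ` partitions n) \<le> card (partitions (Suc n))"
    by (rule card_mono[OF finite_partitions])
  then show ?case
    using step.IH by (simp add: card_image inj_on_def)
qed simp

text \<open>The condition that at least \<open>d\<close> parts are \<open>\<ge> d\<close> is
  inherited by every smaller \<open>d\<close>: fewer parts are demanded and more of them qualify. So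
  the greatest such \<open>d\<close> decides the condition for every \<open>r\<close>.\<close>

lemma le_Dur_iff: "r \<le> Dur p \<longleftrightarrow> r \<le> size {#k \<in># p. r \<le> k#}"
proof
  have bound: "d \<le> size p" if "d \<le> size {#k \<in># p. d \<le> k#}" for d
    using that size_filter_mset_lesseq[of "\<lambda>k. d \<le> k" p] by linarith
  show "r \<le> Dur p" if "r \<le> size {#k \<in># p. r \<le> k#}"
    unfolding Dur_def by (rule Greatest_le_nat[where b = "size p"]) (use that bound in auto)
  assume r: "r \<le> Dur p"
  have "Dur p \<le> size {#k \<in># p. Dur p \<le> k#}"
    unfolding Dur_def by (rule GreatestI_nat[of _ 0 "size p"]) (auto intro: bound)
  also have "\<dots> \<le> size {#k \<in># p. r \<le> k#}"
    using r by (intro size_mset_mono filter_mset_mono_strong) auto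
  finally show "r \<le> size {#k \<in># p. r \<le> k#}"
    using r by simp
qed

lemma filter_replicate_mset:
  "filter_mset P (replicate_mset n x) = (if P x then replicate_mset n x else {#})"
  by (induction n) auto

lemma le_Dur_add: "r \<le> Dur p \<Longrightarrow> r \<le> Dur (p + q)"
  unfolding le_Dur_iff by simp

lemma H_le_card_partitions: "H r n \<le> card (partitions n)"
  unfolding H_def by (intro card_mono finite_partitions) auto

lemma card_partitions_le_H:
  assumes "r > 0"
  shows "card (partitions n) \<le> H r (n + r\<^sup>2)"
proof -
  let ?g = "\<lambda>p. p + replicate_mset r r"
  have "card (partitions n) = card (?g ` partitions n)"
    by (simp add: card_image inj_on_def)
  also have "\<dots> \<le> H r (n + r\<^sup>2)"
    unfolding H_def
  proof (rule card_mono)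
    show "?g ` partitions n \<subseteq> {p \<in> partitions (n + r\<^sup>2). r \<le> Dur p}"
      using assms by (auto simp: partitions_def le_Dur_iff power2_eq_square filter_replicate_mset)
  qed (simp add: finite_partitions)
  finally show ?thesis .
qed

lemma H_less_H_Suc:
  assumes "r \<ge> 2" "n \<ge> r\<^sup>2"
  shows "H r n < H r (Suc n)"
proof -
  let ?S = "\<lambda>n. {p \<in> partitions n. r \<le> Dur p}"
  \<comment> \<open>a partition counted by \<open>H r (Suc n)\<close> without a part 1\<close>
  define q where "q = add_mset (Suc n - (r - 1) * r) (replicate_mset (r - 1) r)"
  have rr: "(r - 1) * r + r = r\<^sup>2"
    using assms by (cases r) (auto simp: power2_eq_square)
  \<comment> \<open>\<open>n \<ge> r\<^sup>2\<close> makes the remaining part of \<open>q\<close>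
    exceed \<open>r\<close>, so all \<open>r\<close> parts of \<open>q\<close> are at least
    \<open>r\<close>, hence at least 2.\<close>
  then have big: "Suc n - (r - 1) * r > r" "(r - 1) * r \<le> Suc n"
    using assms by linarith+
  have "q \<in> ?S (Suc n)"
    using assms big by (auto simp: q_def partitions_def le_Dur_iff filter_replicate_mset)
  moreover have "1 \<notin># q"
    using assms big by (auto simp: q_def)
  moreover have "add_mset 1 ` ?S n \<subseteq> ?S (Suc n)"
    using add_mset_partitions[of 1 _ n] le_Dur_add[of r _ "{#1#}"] by auto
  ultimately have "add_mset 1 ` ?S n \<subset> ?S (Suc n)"
    by (metis (no_types, lifting) imageE psubsetI union_single_eq_member)
  then have "card (add_mset 1 ` ?S n) < card (?S (Suc n))"
    by (intro psubset_card_mono) (simp_all add: finite_partitions)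
  then show ?thesis
    by (simp add: H_def card_image inj_on_def)
qed

section \<open>The generating function of partitions\<close>

text \<open>Bounding the parts by \<open>m\<close> cuts the Euler product down to \<open>m\<close>
  factors, which allows induction on \<open>m\<close>. The coefficients with
  \<open>n \<le> m\<close> do not change.\<close>

definition bounded_partitions :: "nat \<Rightarrow> nat \<Rightarrow> nat multiset set" where
  "bounded_partitions m n = {p \<in> partitions n. \<forall>k \<in># p. k \<le> m}"

lemma finite_bounded_partitions: "finite (bounded_partitions m n)"
  by (simp add: bounded_partitions_def finite_partitions)

lemma bounded_partitions_0: "bounded_partitions 0 n = (if n = 0 then {{#}} else {})"
proof -
  have "p = {#}" if "p \<in> bounded_partitions 0 n" for p
    using that by (cases "p = {#}") (auto simp: bounded_partitions_def partitions_def)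
  moreover have "{#} \<in> bounded_partitions 0 0"
    by (auto simp: bounded_partitions_def partitions_def)
  moreover have "{#} \<notin> bounded_partitions 0 n" if "n \<noteq> 0"
    using that by (auto simp: bounded_partitions_def partitions_def)
  ultimately show ?thesis by auto
qed

lemma card_bounded_partitions_le: "card (bounded_partitions m n) \<le> card (partitions n)"
  unfolding bounded_partitions_def by (intro card_mono finite_partitions) auto

lemma bounded_partitions_eq:
  assumes "n \<le> m"
  shows "bounded_partitions m n = partitions n"
proof -
  have "k \<le> m" if "p \<in> partitions n" "k \<in># p" for p k
    using that assms by (auto simp: partitions_def dest!: multi_member_split)
  then show ?thesis
    by (auto simp: bounded_partitions_def)
qed

text \<open>The partitions are split according to whether the part \<open>Suc m\<close> occurs. If
  it does, one copy is removed; further copies may remain, so the bound stays at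
  \<open>Suc m\<close>.\<close>

lemma card_bounded_partitions_Suc:
  "card (bounded_partitions (Suc m) n) = card (bounded_partitions m n) +
     (if n \<ge> Suc m then card (bounded_partitions (Suc m) (n - Suc m)) else 0)"
proof -
  let ?A = "bounded_partitions m n"
  let ?B = "if n \<ge> Suc m then add_mset (Suc m) ` bounded_partitions (Suc m) (n - Suc m) else {}"
  have "bounded_partitions (Suc m) n = ?A \<union> ?B"
  proof (intro equalityI subsetI)
    fix p assume p: "p \<in> bounded_partitions (Suc m) n"
    show "p \<in> ?A \<union> ?B"
    proof (cases "Suc m \<in># p")
      case True
      then obtain q where q: "p = add_mset (Suc m) q"
        by (auto dest: multi_member_split)
      then have "n \<ge> Suc m" "q \<in> bounded_partitions (Suc m) (n - Suc m)"
        using p by (auto simp: bounded_partitions_def partitions_def)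
      then show ?thesis using q by auto
    next
      case False
      then have "k \<le> m" if "k \<in># p" for k
        using that p by (metis (mono_tags, lifting) bounded_partitions_def le_SucE mem_Collect_eq)
      then show ?thesis using p by (auto simp: bounded_partitions_def)
    qed
  next
    fix p assume "p \<in> ?A \<union> ?B"
    then show "p \<in> bounded_partitions (Suc m) n"
      by (auto simp: bounded_partitions_def partitions_def split: if_splits)
  qed
  moreover have "?A \<inter> ?B = {}"
    by (auto simp: bounded_partitions_def)
  ultimately have "card (bounded_partitions (Suc m) n) = card ?A + card ?B"
    by (simp add: card_Un_disjoint finite_bounded_partitions)
  then show ?thesis
    by (simp add: card_image inj_on_def)
qed

text \<open>Summing the recurrence gives \<open>G = F + x * G\<close>; in the application
  \<open>x = q ^ k\<close> is the weight of one part \<open>k\<close>. Convergence has to come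
  first: \<open>g\<close> is nonnegative, so the shift by \<open>k\<close> only drops terms, and
  every partial sum \<open>S\<close> satisfies \<open>S \<le> F + x * S\<close>.\<close>

lemma sums_geometric_recurrence:
  fixes f g :: "nat \<Rightarrow> real"
  assumes x: "0 \<le> x" "x < 1" and "k > 0"
    and f: "f sums F" and f_nonneg: "\<And>n. f n \<ge> 0"
    and g: "\<And>n. g n = f n + (if n \<ge> k then x * g (n - k) else 0)"
  shows "g sums (F / (1 - x))"
proof -
  have g_nonneg: "g n \<ge> 0" for n
  proof (induction n rule: less_induct)
    case (less n)
    then show ?case using \<open>k > 0\<close> x f_nonneg[of n] by (subst g) auto
  qed
  let ?h = "\<lambda>n. if n \<ge> k then x * g (n - k) else 0"
  have part: "sum ?h {..<N} = x * sum g {..<N - k}" for N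
  proof -
    have "sum ?h {..<N} = (\<Sum>n\<in>{k..<N}. x * g (n - k))"
      by (rule sum.mono_neutral_cong_right) auto
    also have "\<dots> = (\<Sum>n<N - k. x * g n)"
      by (rule sum.reindex_bij_witness[of _ "\<lambda>n. n + k" "\<lambda>n. n - k"]) auto
    finally show ?thesis by (simp add: sum_distrib_left)
  qed
  have "sum g {..<N} \<le> F / (1 - x)" for N
  proof -
    have "sum g {..<N} = sum f {..<N} + sum ?h {..<N}"
      by (subst sum.distrib[symmetric]) (auto intro!: sum.cong simp: g[symmetric])
    also have "sum f {..<N} \<le> F"
      using f f_nonneg by (metis sum_le_suminf sums_iff finite_lessThan)
    also have "sum ?h {..<N} \<le> x * sum g {..<N}"
      unfolding part using x g_nonneg by (intro mult_left_mono sum_mono2) auto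
    finally show ?thesis
      using x by (simp add: field_simps)
  qed
  then have "summable g"
    using g_nonneg by (intro summableI_nonneg_bounded)
  then have "g sums suminf g"
    by (rule summable_sums)
  then have "(\<lambda>n. x * g n) sums (x * suminf g)"
    by (rule sums_mult)
  moreover have "(\<lambda>n. ?h (n + k)) = (\<lambda>n. x * g n)"
    by auto
  ultimately have "?h sums (x * suminf g)"
    using sums_iff_shift'[of ?h k "x * suminf g"] by (simp add: sum.neutral)
  from sums_add[OF f this] have "g sums (F + x * suminf g)"
    by (simp add: g[symmetric])
  moreover have "F + x * suminf g = F / (1 - x)"
    using sums_unique[OF calculation] x by (simp add: field_simps)
  ultimately show ?thesis by simp
qed

lemma bounded_partitions_sums:
  fixes q :: real
  assumes q: "0 < q" "q < 1"
  shows "(\<lambda>n. card (bounded_partitions m n) * q ^ n) sums (\<Prod>k=1..m. 1 / (1 - q ^ k))"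
proof (induction m)
  case 0
  have "(\<lambda>n. card (bounded_partitions 0 n) * q ^ n) = (\<lambda>n. if n = 0 then 1 else 0)"
    by (auto simp: bounded_partitions_0)
  then show ?case
    using sums_single[of 0 "\<lambda>_. 1::real"] by simp
next
  case (Suc m)
  have "(\<lambda>n. card (bounded_partitions (Suc m) n) * q ^ n) sums
          ((\<Prod>k=1..m. 1 / (1 - q ^ k)) / (1 - q ^ Suc m))"
  proof (rule sums_geometric_recurrence[where k = "Suc m", OF _ _ _ Suc])
    show "q ^ Suc m < 1"
      using q by (intro power_Suc_less_one) auto
    show "card (bounded_partitions (Suc m) n) * q ^ n = card (bounded_partitions m n) * q ^ n +
        (if n \<ge> Suc m then q ^ Suc m *
           (card (bounded_partitions (Suc m) (n - Suc m)) * q ^ (n - Suc m)) else 0)" for n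
    proof (cases "n \<ge> Suc m")
      case True
      then have "q ^ n = q ^ Suc m * q ^ (n - Suc m)"
        by (metis le_add_diff_inverse power_add)
      then show ?thesis
        using True by (simp add: card_bounded_partitions_Suc[of m n] algebra_simps)
    qed (simp add: card_bounded_partitions_Suc[of m n])
  qed (use q in auto)
  then show ?case by simp
qed

section \<open>The logarithm of the finite Euler product\<close>

lemma neg_ln_one_minus_sums:
  fixes x :: real
  assumes "0 \<le> x" "x < 1"
  shows "(\<lambda>j. x ^ j / j) sums (- ln (1 - x))"
  using sums_minus[OF ln_series'[of "- x"]] assms by simp

lemma euler_product_eq_exp:
  fixes t :: real
  assumes "t > 0"
  shows "(\<Prod>k=1..m. 1 / (1 - exp (- t) ^ k)) = exp (\<Sum>k=1..m. - ln (1 - exp (- t) ^ k))"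
  unfolding exp_sum[OF finite_atLeastAtMost]
proof (rule prod.cong)
  fix k assume "k \<in> {1..m}"
  then have "exp (- t) ^ k < 1"
    using assms by (simp add: exp_of_nat_mult[symmetric])
  then show "1 / (1 - exp (- t) ^ k) = exp (- ln (1 - exp (- t) ^ k))"
    by (simp add: exp_minus inverse_eq_divide)
qed simp

text \<open>Expanding every logarithm of the Euler product and summing over \<open>k\<close> first. The term
  \<open>j = 0\<close> vanishes because of the division by zero.\<close>

lemma log_euler_product_sums:
  fixes t :: real
  assumes "t > 0"
  shows "(\<lambda>j. (\<Sum>k=1..m. exp (- (real j * t)) ^ k) / j) sums (\<Sum>k=1..m. - ln (1 - exp (- t) ^ k))"
proof -
  have "(\<lambda>j. \<Sum>k=1..m. (exp (- t) ^ k) ^ j / j) sums (\<Sum>k=1..m. - ln (1 - exp (- t) ^ k))"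
  proof (rule sums_sum, rule neg_ln_one_minus_sums)
    fix k assume "k \<in> {1..m}"
    then show "exp (- t) ^ k < 1"
      using assms by (simp add: exp_of_nat_mult[symmetric])
  qed simp
  moreover have "(exp (- t) ^ k) ^ j = exp (- (real j * t)) ^ k" for k j :: nat
    using exp_of_nat_mult[of j "- t"] by (simp add: power_mult[symmetric] mult.commute)
  ultimately show ?thesis
    by (simp add: sum_divide_distrib)
qed

text \<open>The infinite series has the value \<open>1 / (exp u - 1)\<close>, and
  \<open>exp u \<ge> 1 + u\<close>.\<close>

lemma geometric_sum_le:
  fixes u :: real
  assumes "u > 0"
  shows "(\<Sum>k=1..m. exp (- u) ^ k) \<le> 1 / u"
proof -
  let ?x = "exp (- u)"
  have x: "0 < ?x" "?x < 1" using assms by auto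
  have "(\<Sum>k=1..m. ?x ^ k) = ?x * (\<Sum>k<m. ?x ^ k)"
    by (simp add: sum_distrib_left sum.atLeast1_atMost_eq)
  also have "\<dots> = ?x * (1 - ?x ^ m) / (1 - ?x)"
    using x by (simp add: sum_gp_strict)
  also have "\<dots> \<le> ?x * 1 / (1 - ?x)"
    using x by (intro divide_right_mono mult_left_mono) auto
  also have "\<dots> \<le> 1 / u"
  proof -
    have "u * ?x \<le> 1 - ?x"
      using exp_ge_add_one_self[of u] by (simp add: exp_minus field_simps)
    then show ?thesis using x assms by (simp add: field_simps)
  qed
  finally show ?thesis .
qed

text \<open>The term of index 0 is \<open>1 / 0 = 0\<close>, so the series can be compared term by
  term with \<open>log_euler_product_sums\<close>.\<close>

lemma zeta_2_sums: "(\<lambda>j. 1 / (real j)\<^sup>2) sums (pi\<^sup>2 / 6)"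
  using inverse_squares_sums sums_Suc_iff[of "\<lambda>j. 1 / (real j)\<^sup>2" "pi\<^sup>2 / 6"] by simp

text \<open>By \<open>geometric_sum_le\<close> with \<open>u = j * t\<close>, the
  \<open>j\<close>-th term of the expanded logarithm is at most \<open>1 / (j\<^sup>2 * t)\<close>.
  The resulting bound is uniform in \<open>m\<close>.\<close>

lemma euler_product_le:
  fixes t :: real
  assumes "t > 0"
  shows "(\<Prod>k=1..m. 1 / (1 - exp (- t) ^ k)) \<le> exp ((pi\<^sup>2 / 6) / t)"
proof -
  have "(\<Sum>k=1..m. exp (- (real j * t)) ^ k) / j \<le> 1 / (real j)\<^sup>2 / t" for j :: nat
  proof (cases "j = 0")
    case False
    then have "(\<Sum>k=1..m. exp (- (real j * t)) ^ k) \<le> 1 / (real j * t)"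
      using assms by (intro geometric_sum_le) simp
    then have "(\<Sum>k=1..m. exp (- (real j * t)) ^ k) / j \<le> 1 / (real j * t) / j"
      by (intro divide_right_mono) auto
    then show ?thesis by (simp add: power2_eq_square mult_ac)
  qed simp
  then have "(\<Sum>k=1..m. - ln (1 - exp (- t) ^ k)) \<le> (pi\<^sup>2 / 6) / t"
    using log_euler_product_sums[OF assms] sums_divide[OF zeta_2_sums] by (rule sums_le)
  then show ?thesis
    unfolding euler_product_eq_exp[OF assms] by simp
qed

text \<open>All terms of the expanded logarithm are nonnegative, so truncation bounds it from below.
  With finitely many \<open>j\<close>, the limits in \<open>m\<close> and later in \<open>t\<close>
  can be taken term by term.\<close>

lemma le_euler_product:
  fixes t :: real
  assumes "t > 0"
  shows "exp (\<Sum>j\<in>{1..J::nat}. (\<Sum>k=1..m. exp (- (real j * t)) ^ k) / j)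
           \<le> (\<Prod>k=1..m. 1 / (1 - exp (- t) ^ k))"
proof -
  let ?f = "\<lambda>j::nat. (\<Sum>k=1..m. exp (- (real j * t)) ^ k) / j"
  have "sum ?f {1..J} \<le> suminf ?f"
    using log_euler_product_sums[OF assms, THEN sums_summable]
    by (intro sum_le_suminf) (auto intro!: sum_nonneg divide_nonneg_nonneg)
  also have "suminf ?f = (\<Sum>k=1..m. - ln (1 - exp (- t) ^ k))"
    using log_euler_product_sums[OF assms] by (simp add: sums_iff)
  finally show ?thesis
    unfolding euler_product_eq_exp[OF assms] by simp
qed

text \<open>A partial sum over \<open>n < N\<close> only sees partitions with parts at most
  \<open>N\<close>, so it is bounded by the product of \<open>N\<close> factors, for which
  \<open>euler_product_le\<close> gives a bound independent of \<open>N\<close>.\<close>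

lemma partitions_summable:
  fixes t :: real
  assumes "t > 0"
  shows "summable (\<lambda>n. card (partitions n) * exp (- (n * t)))" (is "summable ?f")
    and "(\<Sum>n. card (partitions n) * exp (- (n * t))) \<le> exp ((pi\<^sup>2 / 6) / t)"
proof -
  have bound: "sum ?f {..<N} \<le> exp ((pi\<^sup>2 / 6) / t)" for N
  proof -
    let ?g = "\<lambda>n. card (bounded_partitions N n) * exp (- t) ^ n"
    have g: "?g sums (\<Prod>k=1..N. 1 / (1 - exp (- t) ^ k))"
      using assms by (intro bounded_partitions_sums) auto
    have "sum ?f {..<N} = sum ?g {..<N}"
      by (intro sum.cong) (auto simp: bounded_partitions_eq exp_of_nat_mult[symmetric])
    also have "\<dots> \<le> suminf ?g"
      using g by (intro sum_le_suminf) (auto simp: sums_iff)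
    also have "\<dots> \<le> exp ((pi\<^sup>2 / 6) / t)"
      using g euler_product_le[OF assms, of N] by (simp add: sums_iff)
    finally show ?thesis .
  qed
  show "summable ?f"
    by (rule summableI_nonneg_bounded[OF _ bound]) simp
  then show "suminf ?f \<le> exp ((pi\<^sup>2 / 6) / t)"
    by (rule suminf_le_const) (rule bound)
qed

section \<open>Lower bounds for the generating function\<close>

lemma euler_product_le_partitions:
  fixes t :: real
  assumes "t > 0"
  shows "(\<Prod>k=1..m. 1 / (1 - exp (- t) ^ k)) \<le> (\<Sum>n. card (partitions n) * exp (- (n * t)))"
proof -
  have *: "(\<lambda>n. card (bounded_partitions m n) * exp (- t) ^ n) sums
          (\<Prod>k=1..m. 1 / (1 - exp (- t) ^ k))"
    using assms by (intro bounded_partitions_sums) auto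
  have "card (bounded_partitions m n) * exp (- t) ^ n
      \<le> card (partitions n) * exp (- (n * t))" for n
    by (simp add: exp_of_nat_mult[symmetric] card_bounded_partitions_le mult_right_mono)
  then show ?thesis
    by (rule sums_le[OF _ * summable_sums[OF partitions_summable(1)[OF assms]]])
qed

text \<open>This is the limit \<open>m \<rightarrow> \<infinity>\<close> for fixed \<open>J\<close>,
  in which the inner geometric sums become full series.\<close>

lemma le_partitions_generating_function:
  fixes t :: real
  assumes "t > 0"
  shows "exp (\<Sum>j=1..J. 1 / (exp (real j * t) - 1) / j)
           \<le> (\<Sum>n. card (partitions n) * exp (- (n * t)))"
proof (rule LIMSEQ_le_const2)
  show "(\<lambda>m. exp (\<Sum>j=1..J::nat. (\<Sum>k=1..m. exp (- (real j * t)) ^ k) / j)) \<longlonglongrightarrow>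
          exp (\<Sum>j=1..J. 1 / (exp (real j * t) - 1) / j)"
  proof (intro tendsto_exp tendsto_sum tendsto_divide tendsto_const)
    fix j assume j: "j \<in> {1..J}"
    let ?x = "exp (- (real j * t))"
    have x: "0 < ?x" "?x < 1"
      using j assms by auto
    then have "(\<lambda>k. ?x * ?x ^ k) sums (?x * (1 / (1 - ?x)))"
      by (intro sums_mult geometric_sums) simp
    then have "(\<lambda>m. \<Sum>k<m. ?x * ?x ^ k) \<longlonglongrightarrow> ?x * (1 / (1 - ?x))"
      by (simp add: sums_def)
    moreover have "?x * (1 / (1 - ?x)) = 1 / (exp (real j * t) - 1)"
      using x by (simp add: exp_minus field_simps)
    ultimately show "(\<lambda>m. \<Sum>k=1..m. ?x ^ k) \<longlonglongrightarrow> 1 / (exp (real j * t) - 1)"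
      by (simp add: sum.atLeast1_atMost_eq)
  qed auto
  show "\<exists>N. \<forall>m\<ge>N. exp (\<Sum>j=1..J::nat. (\<Sum>k=1..m. exp (- (real j * t)) ^ k) / j)
          \<le> (\<Sum>n. card (partitions n) * exp (- (n * t)))"
    using order_trans[OF le_euler_product[OF assms] euler_product_le_partitions[OF assms]] by blast
qed

text \<open>Finitely many terms of the series for \<open>pi\<^sup>2 / 6\<close> already exceed
  \<open>b\<close>. After multiplication by \<open>t\<close>, the exponent in
  \<open>le_partitions_generating_function\<close> tends to their sum, because
  \<open>t / (exp (j * t) - 1)\<close> tends to \<open>1 / j\<close> as \<open>t\<close> decreases
  to 0.\<close>

lemma eventually_le_partitions_generating_function:
  assumes "b < pi\<^sup>2 / 6"
  shows "eventually (\<lambda>t::real. exp (b / t) \<le> (\<Sum>n. card (partitions n) * exp (- (n * t)))) (at_right 0)"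
proof -
  have "(\<lambda>J. \<Sum>j<J. 1 / (real j)\<^sup>2) \<longlonglongrightarrow> pi\<^sup>2 / 6"
    using zeta_2_sums by (simp add: sums_def)
  from order_tendstoD(1)[OF this assms]
  obtain K where K: "b < (\<Sum>j<K. 1 / (real j)\<^sup>2)"
    by (auto simp: eventually_at_top_linorder)
  also have "\<dots> \<le> (\<Sum>j\<in>{..K}. 1 / (real j)\<^sup>2)"
    by (intro sum_mono2) auto
  also have "\<dots> = (\<Sum>j=1..K. 1 / (real j)\<^sup>2)"
    by (intro sum.mono_neutral_right) auto
  finally have b: "b < (\<Sum>j=1..K. 1 / (real j)\<^sup>2)" .
  have "((\<lambda>t. \<Sum>j=1..K. t / (exp (real j * t) - 1) / j) \<longlongrightarrow> (\<Sum>j=1..K. 1 / real j / j))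
          (at_right 0)"
  proof (rule tendsto_sum, rule tendsto_divide[OF _ tendsto_const])
    fix j assume j: "j \<in> {1..K}"
    have "((\<lambda>t. exp (real j * t)) has_real_derivative real j) (at 0)"
      by (auto intro!: derivative_eq_intros)
    then have "((\<lambda>t. (exp (real j * t) - 1) / t) \<longlongrightarrow> real j) (at 0)"
      by (simp add: has_field_derivative_iff)
    then have "((\<lambda>t. inverse ((exp (real j * t) - 1) / t)) \<longlongrightarrow> inverse (real j)) (at 0)"
      using j by (intro tendsto_inverse) auto
    then show "((\<lambda>t. t / (exp (real j * t) - 1)) \<longlongrightarrow> 1 / real j) (at_right 0)"
      by (simp add: inverse_eq_divide filterlim_at_split)
  qed auto
  moreover have "b < (\<Sum>j=1..K. 1 / real j / j)"
    using b by (simp add: power2_eq_square)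
  ultimately have "eventually (\<lambda>t. b < (\<Sum>j=1..K. t / (exp (real j * t) - 1) / j)) (at_right 0)"
    by (rule order_tendstoD(1))
  then show ?thesis
    using eventually_at_right_less[of 0]
  proof eventually_elim
    case (elim t)
    have "b / t \<le> (\<Sum>j=1..K. t / (exp (real j * t) - 1) / j) / t"
      using elim by (intro divide_right_mono) auto
    also have "\<dots> = (\<Sum>j=1..K. 1 / (exp (real j * t) - 1) / j)"
      using elim by (simp add: sum_divide_distrib)
    finally have "exp (b / t) \<le> exp (\<Sum>j=1..K. 1 / (exp (real j * t) - 1) / j)"
      by simp
    also have "\<dots> \<le> (\<Sum>n. card (partitions n) * exp (- (n * t)))"
      using elim by (intro le_partitions_generating_function) auto
    finally show ?case .
  qed
qed

section \<open>A Tauberian theorem\<close>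

text \<open>The left-hand sides are the exponents of the two tails in \<open>series_split\<close>.
  In both, the terms linear in \<open>e\<close> cancel and the relative excess over 1 is at most
  \<open>2 * e\<^sup>2 - e * d\<close>. The choice \<open>e = d / 4\<close> minimises this, with
  value \<open>- d\<^sup>2 / 8\<close>.\<close>

lemma tail_bounds:
  fixes d e X :: real
  assumes "0 < d" "d < 1" "e = d / 4" "X \<ge> 0"
  shows "X / (1 - e) - e * ((1 + d) * X) \<le> X * (1 - d\<^sup>2 / 8)"
    and "X / (1 + e) + e * ((1 - d) * X) \<le> X * (1 - d\<^sup>2 / 8)"
proof -
  have "1 / (1 - e) \<le> 1 + e + 2 * e\<^sup>2"
  proof -
    have "(1 + e + 2 * e\<^sup>2) * (1 - e) - 1 = e\<^sup>2 * (1 - 2 * e)"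
      by (simp add: algebra_simps power2_eq_square)
    moreover have "e\<^sup>2 * (1 - 2 * e) \<ge> 0"
      using assms by (intro mult_nonneg_nonneg) auto
    ultimately have "1 \<le> (1 + e + 2 * e\<^sup>2) * (1 - e)"
      by linarith
    moreover have "e < 1"
      using assms by simp
    ultimately show ?thesis
      by (simp add: pos_divide_le_eq)
  qed
  moreover have "1 + e + 2 * e\<^sup>2 = e * (1 + d) + (1 - d\<^sup>2 / 8)"
    unfolding assms(3) by (simp add: field_simps power2_eq_square)
  ultimately have "1 / (1 - e) - e * (1 + d) \<le> 1 - d\<^sup>2 / 8"
    by linarith
  then have "X * (1 / (1 - e) - e * (1 + d)) \<le> X * (1 - d\<^sup>2 / 8)"
    using assms by (intro mult_left_mono)
  then show "X / (1 - e) - e * ((1 + d) * X) \<le> X * (1 - d\<^sup>2 / 8)"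
    by (simp add: algebra_simps)
  have "1 / (1 + e) \<le> 1 - e + e\<^sup>2"
  proof -
    have "(1 - e + e\<^sup>2) * (1 + e) - 1 = e ^ 3"
      by (simp add: algebra_simps power2_eq_square power3_eq_cube)
    moreover have "e ^ 3 \<ge> 0"
      using assms by simp
    ultimately have "1 \<le> (1 - e + e\<^sup>2) * (1 + e)"
      by linarith
    moreover have "1 + e > 0"
      using assms by simp
    ultimately show ?thesis
      by (simp add: pos_divide_le_eq)
  qed
  also have "\<dots> \<le> 1 - e + 2 * e\<^sup>2"
    by simp
  also have "\<dots> = 1 - e * (1 - d) - d\<^sup>2 / 8"
    unfolding assms(3) by (simp add: field_simps power2_eq_square)
  finally have "X * (1 / (1 + e) + e * (1 - d)) \<le> X * (1 - d\<^sup>2 / 8)"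
    using assms by (intro mult_left_mono) auto
  then show "X / (1 + e) + e * ((1 - d) * X) \<le> X * (1 - d\<^sup>2 / 8)"
    by (simp add: algebra_simps)
qed

text \<open>At the saddle point \<open>t\<close> the terms with index outside
  \<open>[(1 - d) b / t\<^sup>2, (1 + d) b / t\<^sup>2]\<close> contribute a negligible part of the series: weighting them by
  \<open>exp (\<plusminus> e t (n - N))\<close> compares them with the series at \<open>(1 \<minusplus> e) t\<close>. Monotonicity
  turns the lower bound on the sum of the remaining terms into one on the last of them.\<close>

locale exponential_growth_series =
  fixes a :: "nat \<Rightarrow> real" and b :: real
  assumes b_pos: "b > 0"
    and a_pos: "\<And>n. a n > 0"
    and a_mono: "mono a"
    and a_summable: "\<And>t::real. t > 0 \<Longrightarrow> summable (\<lambda>n. a n * exp (- (n * t)))"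
    and series_le: "\<And>t::real. t > 0 \<Longrightarrow> (\<Sum>n. a n * exp (- (n * t))) \<le> exp (b / t)"
    and series_ge: "\<And>b'. b' < b \<Longrightarrow>
          eventually (\<lambda>t::real. exp (b' / t) \<le> (\<Sum>n. a n * exp (- (n * t)))) (at_right 0)"
begin

text \<open>A single term is at most the whole series, whence
  \<open>ln (a n) \<le> b / t + n * t\<close>. The choice \<open>t = sqrt (b / n)\<close> minimises
  the right-hand side.\<close>

lemma ln_le:
  assumes "n > 0"
  shows "ln (a n) \<le> 2 * sqrt b * sqrt n"
proof -
  define t where "t = sqrt (b / n)"
  have t: "t > 0"
    using assms b_pos by (simp add: t_def)
  have "a n * exp (- (n * t)) \<le> (\<Sum>n. a n * exp (- (n * t)))"
    using sum_le_suminf[OF a_summable[OF t], of "{n}"] less_imp_le[OF a_pos] by simp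
  also have "\<dots> \<le> exp (b / t)"
    using t by (rule series_le)
  finally have "a n \<le> exp (b / t + n * t)"
    by (simp add: exp_minus exp_add field_simps)
  then have "ln (a n) \<le> b / t + n * t"
    using a_pos by (metis ln_exp ln_mono)
  also have "b / t = sqrt b * sqrt n"
    using assms b_pos by (simp add: t_def real_sqrt_divide real_div_sqrt field_simps)
  also have "n * t = sqrt b * sqrt n"
    using assms b_pos by (simp add: t_def real_sqrt_divide real_div_sqrt field_simps)
  finally show ?thesis by simp
qed

lemma series_split:
  fixes t d e :: real
  assumes t: "t > 0" and d: "0 < d" "d < 1" and e: "e = d / 4"
    and N: "real N * t = (1 + d) * (b / t)"
  shows "(\<Sum>n. a n * exp (- (n * t))) \<le>
           2 * exp (b / t * (1 - d\<^sup>2 / 8)) + N * (a N * exp (- ((1 - d) * (b / t))))"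
proof -
  define X where "X = b / t"
  have X: "X > 0"
    using b_pos t by (simp add: X_def)
  let ?s1 = "(1 - e) * t" and ?s2 = "(1 + e) * t"
  have s: "?s1 > 0" "?s2 > 0"
    using t d e by auto
  let ?f = "\<lambda>t n. a n * exp (- (real n * t))"
  \<comment> \<open>\<open>N\<close> is the right end of the window, so \<open>a n \<le> a N\<close>
    inside it, and \<open>n * t > (1 - d) * X\<close> bounds the exponential. The bound is charged
    to every index below \<open>N\<close>, which produces the factor \<open>N\<close>.\<close>
  let ?h = "\<lambda>n. if n \<in> {..<N} then a N * exp (- ((1 - d) * X)) else 0"
  let ?g = "\<lambda>n. exp (- (e * ((1 + d) * X))) * ?f ?s1 n + exp (e * ((1 - d) * X)) * ?f ?s2 n + ?h n"
  have "?f t n \<le> ?g n" for n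
  proof -
    have nonneg: "0 \<le> exp (- (e * ((1 + d) * X))) * ?f ?s1 n" "0 \<le> exp (e * ((1 - d) * X)) * ?f ?s2 n"
      "0 \<le> ?h n"
      using less_imp_le[OF a_pos] by auto
    consider "n \<ge> N" | "n * t \<le> (1 - d) * X" | "n < N" "n * t > (1 - d) * X"
      by linarith
    then show ?thesis
    proof cases
      case 1
      then have "(1 + d) * X \<le> n * t"
        using t by (simp add: N[folded X_def, symmetric])
      then have "e * ((1 + d) * X) \<le> e * (n * t)"
        using e d by (intro mult_left_mono) auto
      then have "exp (- (n * t)) \<le> exp (- (e * ((1 + d) * X))) * exp (- (n * ?s1))"
        by (simp add: exp_add[symmetric] algebra_simps)
      then have "?f t n \<le> a n * (exp (- (e * ((1 + d) * X))) * exp (- (n * ?s1)))"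
        using less_imp_le[OF a_pos] by (intro mult_left_mono) auto
      then show ?thesis using nonneg by (simp add: mult_ac)
    next
      case 2
      then have "e * (n * t) \<le> e * ((1 - d) * X)"
        using e d by (intro mult_left_mono) auto
      then have "exp (- (n * t)) \<le> exp (e * ((1 - d) * X)) * exp (- (n * ?s2))"
        by (simp add: exp_add[symmetric] algebra_simps)
      then have "?f t n \<le> a n * (exp (e * ((1 - d) * X)) * exp (- (n * ?s2)))"
        using less_imp_le[OF a_pos] by (intro mult_left_mono) auto
      then show ?thesis using nonneg by (simp add: mult_ac)
    next
      case 3
      then have "?f t n \<le> a N * exp (- ((1 - d) * X))"
        using monoD[OF a_mono, of n N] less_imp_le[OF a_pos] by (intro mult_mono) auto
      then show ?thesis using nonneg 3 by simp
    qed
  qed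
  moreover have "?g sums (exp (- (e * ((1 + d) * X))) * suminf (?f ?s1)
      + exp (e * ((1 - d) * X)) * suminf (?f ?s2) + sum (\<lambda>n. a N * exp (- ((1 - d) * X))) {..<N})"
    by (intro sums_add sums_mult summable_sums a_summable s sums_If_finite_set) simp
  ultimately have "suminf (?f t) \<le> exp (- (e * ((1 + d) * X))) * suminf (?f ?s1)
      + exp (e * ((1 - d) * X)) * suminf (?f ?s2) + sum (\<lambda>n. a N * exp (- ((1 - d) * X))) {..<N}"
    by (rule sums_le[OF _ summable_sums[OF a_summable[OF t]]])
  also have "exp (- (e * ((1 + d) * X))) * suminf (?f ?s1) \<le> exp (X * (1 - d\<^sup>2 / 8))"
  proof -
    have "exp (- (e * ((1 + d) * X))) * suminf (?f ?s1) \<le> exp (- (e * ((1 + d) * X))) * exp (b / ?s1)"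
      by (intro mult_left_mono series_le s) simp
    also have "\<dots> = exp (X / (1 - e) - e * ((1 + d) * X))"
      by (simp add: exp_add[symmetric] X_def mult.commute)
    finally show ?thesis
      using tail_bounds(1)[OF d e less_imp_le[OF X]] by (meson exp_le_cancel_iff order_trans)
  qed
  also have "exp (e * ((1 - d) * X)) * suminf (?f ?s2) \<le> exp (X * (1 - d\<^sup>2 / 8))"
  proof -
    have "exp (e * ((1 - d) * X)) * suminf (?f ?s2) \<le> exp (e * ((1 - d) * X)) * exp (b / ?s2)"
      by (intro mult_left_mono series_le s) simp
    also have "\<dots> = exp (X / (1 + e) + e * ((1 - d) * X))"
      by (simp add: exp_add[symmetric] X_def mult.commute add.commute)
    finally show ?thesis
      using tail_bounds(2)[OF d e less_imp_le[OF X]] by (meson exp_le_cancel_iff order_trans)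
  qed
  finally show ?thesis
    by (simp add: X_def)
qed

lemma eventually_ln_ge:
  assumes d: "0 < d" "d < 1"
  shows "eventually (\<lambda>N. 2 * sqrt b * ((1 - d) / sqrt (1 + d)) * sqrt N - ln (2 * real N) \<le> ln (a N))
           sequentially"
proof -
  \<comment> \<open>This \<open>c\<close> makes the given \<open>N\<close> the right end of the
    window at \<open>t N = c / sqrt N\<close>.\<close>
  define c where "c = sqrt ((1 + d) * b)"
  have c: "c > 0"
    using d b_pos by (simp add: c_def)
  define t where "t N = c / sqrt (real N)" for N
  have Nt: "real N * t N = (1 + d) * (b / t N)" "b / t N = sqrt N * (b / c)" if "N > 0" for N
  proof -
    have cc: "c * c = (1 + d) * b"
      using d b_pos by (simp add: c_def)
    have "(1 + d) * (b / t N) = c * c / t N"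
      by (simp add: cc)
    also have "\<dots> = c * sqrt N"
      using c by (simp add: t_def)
    also have "\<dots> = real N * t N"
      unfolding t_def by (metis mult.commute of_nat_0_le_iff real_div_sqrt times_divide_eq_right)
    finally show "real N * t N = (1 + d) * (b / t N)" by simp
    show "b / t N = sqrt N * (b / c)"
      by (simp add: t_def)
  qed
  have sqrt_lim: "filterlim (\<lambda>N. sqrt (real N)) at_top sequentially"
    by (rule filterlim_compose[OF sqrt_at_top filterlim_real_sequentially])
  have "filterlim t (at_right 0) sequentially"
  proof (rule tendsto_imp_filterlim_at_right)
    show "t \<longlonglongrightarrow> 0"
      unfolding t_def by (rule tendsto_divide_0[OF tendsto_const])
        (rule filterlim_at_top_imp_at_infinity[OF sqrt_lim])
    show "eventually (\<lambda>N. t N > 0) sequentially"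
      using eventually_gt_at_top[of 0] by eventually_elim (use c in \<open>simp add: t_def\<close>)
  qed
  \<comment> \<open>Only half of the saving \<open>d\<^sup>2 / 8\<close> in the tails is given up
    here; the other half makes the tails negligible.\<close>
  moreover have "b * (1 - d\<^sup>2 / 16) < b"
    using b_pos d by simp
  ultimately have ge: "eventually (\<lambda>N. exp (b * (1 - d\<^sup>2 / 16) / t N) \<le>
      (\<Sum>n. a n * exp (- (real n * t N)))) sequentially"
    using eventually_compose_filterlim[OF series_ge] by blast
  have "filterlim (\<lambda>N. sqrt (real N) * (b / c)) at_top sequentially"
    by (rule filterlim_at_top_mult_tendsto_pos[OF tendsto_const _ sqrt_lim]) (use b_pos c in simp)
  \<comment> \<open>For \<open>X = b / t N\<close> this means
    \<open>exp (X * d\<^sup>2 / 16) \<ge> 4\<close>, so the two tails together are at most half of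
    the lower bound for the series.\<close>
  then have "eventually (\<lambda>N. sqrt (real N) * (b / c) \<ge> ln 4 * (16 / d\<^sup>2)) sequentially"
    by (simp add: filterlim_at_top)
  with ge show ?thesis
    using eventually_gt_at_top[of 0]
  proof eventually_elim
    case (elim N)
    define X where "X = b / t N"
    have X: "X = sqrt N * (b / c)"
      using Nt(2) elim by (simp add: X_def)
    have tpos: "t N > 0"
      using elim c by (simp add: t_def)
    have Xpos: "X > 0"
      using tpos b_pos by (simp add: X_def)
    let ?Z = "exp (X * (1 - d\<^sup>2 / 16))"
    have "?Z \<le> 2 * exp (X * (1 - d\<^sup>2 / 8)) + N * (a N * exp (- ((1 - d) * X)))"
      using elim(1) series_split[OF tpos d refl Nt(1)] elim by (simp add: X_def)
    moreover have "4 * exp (X * (1 - d\<^sup>2 / 8)) \<le> ?Z"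
    proof -
      have "ln 4 \<le> X * (d\<^sup>2 / 16)"
        using elim(2) d unfolding X[symmetric] by (simp add: field_simps)
      then have "exp (ln 4) * exp (X * (1 - d\<^sup>2 / 8)) \<le> exp (X * (d\<^sup>2 / 16)) * exp (X * (1 - d\<^sup>2 / 8))"
        by (intro mult_right_mono iffD2[OF exp_le_cancel_iff]) auto
      also have "\<dots> = ?Z"
        by (simp add: exp_add[symmetric] algebra_simps)
      finally show ?thesis by simp
    qed
    ultimately have "?Z \<le> 2 * N * a N * exp (- ((1 - d) * X))"
      by simp
    then have "?Z * exp ((1 - d) * X) \<le> 2 * N * a N * exp (- ((1 - d) * X)) * exp ((1 - d) * X)"
      by (intro mult_right_mono) auto
    also have "\<dots> = 2 * N * a N"
      by (simp only: mult.assoc exp_add[symmetric]) simp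
    finally have "?Z * exp ((1 - d) * X) \<le> 2 * N * a N" .
    then have "ln (?Z * exp ((1 - d) * X)) \<le> ln (2 * N * a N)"
      using elim a_pos[of N] by (subst ln_le_cancel_iff) auto
    also have "ln (2 * N * a N) = ln (2 * real N) + ln (a N)"
      using elim a_pos[of N] by (subst ln_mult_pos) auto
    finally have "X * (1 - d\<^sup>2 / 16) + (1 - d) * X \<le> ln (2 * real N) + ln (a N)"
      by (simp add: ln_mult_pos)
    \<comment> \<open>The size of the series and the exponential factor at the window each
      contribute at least \<open>(1 - d) * X\<close>; this is the source of the 2 in
      \<open>2 * sqrt b\<close>.\<close>
    moreover have "X * (2 * (1 - d)) \<le> X * (1 - d\<^sup>2 / 16) + (1 - d) * X"
    proof -
      have "d\<^sup>2 / 16 \<le> d"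
        using d by (simp add: power2_eq_square)
      then have "X * (2 * (1 - d)) \<le> X * ((1 - d\<^sup>2 / 16) + (1 - d))"
        using Xpos by (intro mult_left_mono) auto
      then show ?thesis by (simp add: algebra_simps)
    qed
    moreover have "X * (2 * (1 - d)) = 2 * sqrt b * ((1 - d) / sqrt (1 + d)) * sqrt N"
    proof -
      have "b / c = b / sqrt b / sqrt (1 + d)"
        unfolding c_def real_sqrt_mult by (simp add: mult.commute)
      also have "b / sqrt b = sqrt b"
        using b_pos by (simp add: real_div_sqrt)
      finally have "b / c = sqrt b / sqrt (1 + d)" .
      then show ?thesis by (simp add: X)
    qed
    ultimately show ?case by linarith
  qed
qed

theorem ln_over_sqrt_tendsto: "(\<lambda>n. ln (a n) / sqrt n) \<longlonglongrightarrow> 2 * sqrt b"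
proof (rule order_tendstoI)
  fix u assume u: "u > 2 * sqrt b"
  show "eventually (\<lambda>n. ln (a n) / sqrt n < u) sequentially"
    using eventually_gt_at_top[of 0]
  proof eventually_elim
    case (elim n)
    then have "ln (a n) / sqrt n \<le> 2 * sqrt b"
      using ln_le[of n] by (simp add: field_simps)
    then show ?case using u by simp
  qed
next
  fix u assume u: "u < 2 * sqrt b"
  \<comment> \<open>Letting \<open>d\<close> decrease to 0 removes the loss in
    \<open>eventually_ln_ge\<close>, so some fixed \<open>d\<close> already beats \<open>u\<close>.
    The term \<open>ln (2 * N)\<close> is negligible against \<open>sqrt N\<close>.\<close>
  have "((\<lambda>d. 2 * sqrt b * ((1 - d) / sqrt (1 + d))) \<longlongrightarrow> 2 * sqrt b * ((1 - 0) / sqrt (1 + 0)))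
          (at_right 0)"
    by (intro tendsto_intros) auto
  from order_tendstoD(1)[OF this, of u] u
  have "eventually (\<lambda>d. u < 2 * sqrt b * ((1 - d) / sqrt (1 + d))) (at_right 0)"
    by simp
  moreover have "eventually (\<lambda>d::real. 0 < d \<and> d < 1) (at_right 0)"
    using eventually_at_right_real[of 0 1] by simp
  ultimately obtain d where d: "0 < d" "d < 1" and ud: "u < 2 * sqrt b * ((1 - d) / sqrt (1 + d))"
    using eventually_happens'[OF trivial_limit_at_right_real eventually_conj] by blast
  let ?v = "2 * sqrt b * ((1 - d) / sqrt (1 + d))"
  have "(\<lambda>N. ?v - ln (2 * real N) / sqrt N) \<longlonglongrightarrow> ?v - 0"
    by (intro tendsto_diff tendsto_const) real_asymp
  then have "eventually (\<lambda>N. u < ?v - ln (2 * real N) / sqrt N) sequentially"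
    using ud by (intro order_tendstoD(1)) auto
  then show "eventually (\<lambda>n. u < ln (a n) / sqrt n) sequentially"
    using eventually_ln_ge[OF d] eventually_gt_at_top[of 0]
  proof eventually_elim
    case (elim N)
    have "?v - ln (2 * real N) / sqrt N = (?v * sqrt N - ln (2 * real N)) / sqrt N"
      using elim by (simp add: diff_divide_distrib)
    also have "\<dots> \<le> ln (a N) / sqrt N"
      using elim by (intro divide_right_mono) auto
    finally show ?case using elim by simp
  qed
qed

end

lemma partitions_exponential_growth_series:
  "exponential_growth_series (\<lambda>n. card (partitions n)) (pi\<^sup>2 / 6)"
proof
  show "real (card (partitions n)) > 0" for n
    using finite_partitions partitions_nonempty by (simp add: card_gt_0_iff)
qed (use partitions_summable eventually_le_partitions_generating_function card_partitions_mono
     in \<open>auto simp: mono_def\<close>)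

lemma ln_card_partitions_tendsto:
  "(\<lambda>n. ln (card (partitions n)) / sqrt n) \<longlonglongrightarrow> 2 * sqrt (pi\<^sup>2 / 6)"
  by (rule exponential_growth_series.ln_over_sqrt_tendsto[OF partitions_exponential_growth_series])

section \<open>Counting the values of \<open>H\<close>\<close>

lemma ln_H_tendsto:
  assumes "r > 0"
  shows "(\<lambda>n. ln (H r n) / sqrt n) \<longlonglongrightarrow> 2 * sqrt (pi\<^sup>2 / 6)"
proof (rule tendsto_sandwich)
  let ?p = "\<lambda>n. real (card (partitions n))"
  have p_pos: "?p n > 0" for n
    using finite_partitions partitions_nonempty by (simp add: card_gt_0_iff)
  have le_H: "?p (n - r\<^sup>2) \<le> H r n" if "n \<ge> r\<^sup>2" for n
    using card_partitions_le_H[OF assms, of "n - r\<^sup>2"] that by simp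
  \<comment> \<open>The inequality is strict so that \<open>sqrt (n - r\<^sup>2)\<close> is nonzero
    and cancels below.\<close>
  have ev: "eventually (\<lambda>n. n > r\<^sup>2) sequentially"
    by (rule eventually_gt_at_top)
  show "eventually (\<lambda>n. ln (?p (n - r\<^sup>2)) / sqrt n \<le> ln (H r n) / sqrt n) sequentially"
    using ev
  proof eventually_elim
    case (elim n)
    then show ?case
      using le_H[of n] p_pos[of "n - r\<^sup>2"] by (intro divide_right_mono ln_mono) auto
  qed
  show "eventually (\<lambda>n. ln (H r n) / sqrt n \<le> ln (?p n) / sqrt n) sequentially"
    using ev
  proof eventually_elim
    case (elim n)
    then show ?case
      using le_H[of n] p_pos[of "n - r\<^sup>2"] H_le_card_partitions[of r n]
      by (intro divide_right_mono ln_mono) auto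
  qed
  show "(\<lambda>n. ln (?p n) / sqrt n) \<longlonglongrightarrow> 2 * sqrt (pi\<^sup>2 / 6)"
    by (rule ln_card_partitions_tendsto)
  have "(\<lambda>n. ln (?p (n - r\<^sup>2)) / sqrt (real (n - r\<^sup>2)) * (sqrt (real n - real (r\<^sup>2)) / sqrt n))
          \<longlonglongrightarrow> 2 * sqrt (pi\<^sup>2 / 6) * 1"
  proof (rule tendsto_mult)
    show "(\<lambda>n. ln (?p (n - r\<^sup>2)) / sqrt (real (n - r\<^sup>2))) \<longlonglongrightarrow> 2 * sqrt (pi\<^sup>2 / 6)"
      by (rule filterlim_compose[OF ln_card_partitions_tendsto filterlim_minus_const_nat_at_top])
    show "(\<lambda>n. sqrt (real n - real (r\<^sup>2)) / sqrt n) \<longlonglongrightarrow> 1"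
      by real_asymp
  qed
  moreover have "eventually (\<lambda>n. ln (?p (n - r\<^sup>2)) / sqrt (real (n - r\<^sup>2)) *
      (sqrt (real n - real (r\<^sup>2)) / sqrt n) = ln (?p (n - r\<^sup>2)) / sqrt n) sequentially"
    using ev by eventually_elim (auto simp: of_nat_diff)
  ultimately show "(\<lambda>n. ln (?p (n - r\<^sup>2)) / sqrt n) \<longlonglongrightarrow> 2 * sqrt (pi\<^sup>2 / 6)"
    using Lim_transform_eventually by fastforce
qed

text \<open>For large \<open>x\<close>, the count \<open>M\<close> of values up to \<open>x\<close>
  satisfies \<open>f (k + M - 1) \<le> x < f (k + M)\<close>. Both ends have logarithm asymptotic to
  \<open>c * sqrt M\<close>, so \<open>ln x / sqrt M\<close> tends to \<open>c\<close>, and solving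
  for \<open>M\<close> gives the claim.\<close>

lemma counting_function_asymp_equiv:
  fixes f :: "nat \<Rightarrow> nat" and c :: real
  assumes mono: "\<And>n. n \<ge> k \<Longrightarrow> f n < f (Suc n)" and "c > 0"
    and lim: "(\<lambda>n. ln (f n) / sqrt n) \<longlonglongrightarrow> c"
  shows "(\<lambda>x. real (count_upto (f ` {k..}) x)) \<sim>[at_top] (\<lambda>x. (ln x / c)\<^sup>2)"
proof -
  have shift_mono: "strict_mono (\<lambda>j. f (k + j))"
    by (rule strict_mono_Suc_iff[THEN iffD2]) (auto intro: mono)
  \<comment> \<open>This makes \<open>f\<close> unbounded, so that the \<open>LEAST\<close> below
    exists, and positive from \<open>j = 1\<close> on.\<close>
  have ge: "j \<le> f (k + j)" for j
    using seq_suble[OF shift_mono] by simp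
  define M where "M x = (LEAST j. real (f (k + j)) > x)" for x
  have M: "real (f (k + M x)) > x" for x
  proof -
    obtain j :: nat where "x < j" using reals_Archimedean2 by blast
    then have "real (f (k + j)) > x" using ge[of j] by linarith
    then show ?thesis unfolding M_def by (rule LeastI)
  qed
  have le_iff: "real (f (k + j)) \<le> x \<longleftrightarrow> j < M x" for x j
  proof
    assume "real (f (k + j)) \<le> x"
    then have "f (k + j) < f (k + M x)" using M[of x] by linarith
    then show "j < M x" using strict_mono_less[OF shift_mono] by blast
  next
    assume "j < M x"
    then show "real (f (k + j)) \<le> x"
      using not_less_Least[of j "\<lambda>j. real (f (k + j)) > x"] by (simp add: M_def)
  qed
  have count: "count_upto (f ` {k..}) x = M x" for x
  proof -
    have "{k..} = (\<lambda>j. k + j) ` UNIV"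
      by (auto simp: image_iff le_iff_add)
    then have "f ` {k..} = range (\<lambda>j. f (k + j))"
      by (simp add: image_image)
    then have "{m \<in> f ` {k..}. real m \<le> x} = (\<lambda>j. f (k + j)) ` {..<M x}"
      using le_iff[of _ x] by auto
    moreover have "inj_on (\<lambda>j. f (k + j)) {..<M x}"
      using shift_mono strict_mono_imp_inj_on inj_on_subset by blast
    ultimately show ?thesis
      by (simp add: count_upto_def card_image)
  qed
  have M_lim: "filterlim M at_top at_top"
    unfolding filterlim_at_top
  proof
    fix Z
    show "eventually (\<lambda>x. Z \<le> M x) at_top"
      using eventually_ge_at_top[of "real (f (k + Z))"] by eventually_elim (simp add: le_iff)
  qed
  have shifted: "(\<lambda>m. ln (f (m + l)) / sqrt m) \<longlonglongrightarrow> c" for l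
  proof (rule Lim_transform_eventually)
    have "(\<lambda>m. ln (f (m + l)) / sqrt (real (m + l)) * (sqrt (real m + real l) / sqrt m))
            \<longlonglongrightarrow> c * 1"
    proof (rule tendsto_mult)
      show "(\<lambda>m. ln (f (m + l)) / sqrt (real (m + l))) \<longlonglongrightarrow> c"
        using lim by (rule LIMSEQ_ignore_initial_segment)
      show "(\<lambda>m. sqrt (real m + real l) / sqrt m) \<longlonglongrightarrow> 1"
        by real_asymp
    qed
    then show "(\<lambda>m. ln (f (m + l)) / sqrt (real (m + l)) * (sqrt (real m + real l) / sqrt m))
            \<longlonglongrightarrow> c" by simp
    show "eventually (\<lambda>m. ln (f (m + l)) / sqrt (real (m + l)) * (sqrt (real m + real l) / sqrt m) =
            ln (f (m + l)) / sqrt m) sequentially"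
      using eventually_gt_at_top[of 0] by eventually_elim simp
  qed
  \<comment> \<open>Passing to \<open>Suc m\<close> removes the truncated subtraction and reduces
    the claim to \<open>shifted\<close>.\<close>
  have lower: "(\<lambda>m. ln (f (k + (m - 1))) / sqrt m) \<longlonglongrightarrow> c"
  proof (rule LIMSEQ_imp_Suc, rule Lim_transform_eventually)
    have "(\<lambda>m. ln (f (m + k)) / sqrt m * (sqrt m / sqrt (real m + 1))) \<longlonglongrightarrow> c * 1"
      by (rule tendsto_mult[OF shifted]) real_asymp
    then show "(\<lambda>m. ln (f (m + k)) / sqrt m * (sqrt m / sqrt (real m + 1))) \<longlonglongrightarrow> c"
      by simp
    show "eventually (\<lambda>m. ln (f (m + k)) / sqrt m * (sqrt m / sqrt (real m + 1)) =
            ln (f (k + (Suc m - 1))) / sqrt (real (Suc m))) sequentially"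
      using eventually_gt_at_top[of 0] by eventually_elim (simp add: add.commute)
  qed
  \<comment> \<open>\<open>M x - 1 \<ge> 1\<close> ensures through \<open>ge\<close> that the
    logarithm on the lower side is taken of a positive number.\<close>
  have large: "eventually (\<lambda>x. M x \<ge> 2) at_top"
    using M_lim by (simp add: filterlim_at_top)
  have "((\<lambda>x. ln x / sqrt (M x)) \<longlongrightarrow> c) at_top"
  proof (rule tendsto_sandwich)
    show "((\<lambda>x. ln (f (k + (M x - 1))) / sqrt (M x)) \<longlongrightarrow> c) at_top"
      by (rule filterlim_compose[OF lower M_lim])
    show "((\<lambda>x. ln (f (M x + k)) / sqrt (M x)) \<longlongrightarrow> c) at_top"
      by (rule filterlim_compose[OF shifted M_lim])
    show "eventually (\<lambda>x. ln (f (k + (M x - 1))) / sqrt (M x) \<le> ln x / sqrt (M x)) at_top"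
      using large
    proof eventually_elim
      case (elim x)
      then have "real (f (k + (M x - 1))) \<le> x" "f (k + (M x - 1)) > 0"
        using ge[of "M x - 1"] by (simp_all only: le_iff)
      then show ?case by (intro divide_right_mono ln_mono) auto
    qed
    show "eventually (\<lambda>x. ln x / sqrt (M x) \<le> ln (f (M x + k)) / sqrt (M x)) at_top"
      using eventually_gt_at_top[of 0]
    proof eventually_elim
      case (elim x)
      then show ?case
        using M[of x] by (intro divide_right_mono ln_mono) (auto simp: add.commute)
    qed
  qed
  then have "((\<lambda>x. (c / (ln x / sqrt (M x)))\<^sup>2) \<longlongrightarrow> (c / c)\<^sup>2) at_top"
    using \<open>c > 0\<close> by (intro tendsto_intros) auto
  then have "((\<lambda>x. (c / (ln x / sqrt (M x)))\<^sup>2) \<longlongrightarrow> 1) at_top"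
    using \<open>c > 0\<close> by simp
  moreover have "(c / (ln x / sqrt (M x)))\<^sup>2 = real (M x) / (ln x / c)\<^sup>2" for x
    by (simp add: power_divide power_mult_distrib)
  ultimately show ?thesis
    unfolding count by (intro asymp_equivI') simp
qed

theorem theorem6p2:
  fixes r :: nat
  assumes "r \<ge> 2"
  shows "asymp_equiv (\<lambda>x. real (I r x)) at_top (\<lambda>x. 3 / (2 * pi ^ 2) * (ln x) ^ 2)
    \<and> natural_density_zero (H_pos_range r)"
proof
  let ?c = "2 * sqrt (pi\<^sup>2 / 6)"
  have range: "H_pos_range r = H r ` {r\<^sup>2..}"
    by (auto simp: H_pos_range_def)
  have "(\<lambda>x. real (count_upto (H_pos_range r) x)) \<sim>[at_top] (\<lambda>x. (ln x / ?c)\<^sup>2)"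
    unfolding range
    by (rule counting_function_asymp_equiv) (use assms in \<open>auto intro: H_less_H_Suc ln_H_tendsto\<close>)
  \<comment> \<open>The square of \<open>?c\<close> is
    \<open>4 * pi\<^sup>2 / 6 = 2 * pi\<^sup>2 / 3\<close>.\<close>
  moreover have "(ln x / ?c)\<^sup>2 = 3 / (2 * pi ^ 2) * (ln x) ^ 2" for x
    by (simp add: power_divide power_mult_distrib)
  ultimately have count: "(\<lambda>x. real (count_upto (H_pos_range r) x)) \<sim>[at_top]
      (\<lambda>x. 3 / (2 * pi ^ 2) * (ln x) ^ 2)"
    by simp
  then show "(\<lambda>x. real (I r x)) \<sim>[at_top] (\<lambda>x. 3 / (2 * pi ^ 2) * (ln x) ^ 2)"
    by (simp add: I_def)
  have "(\<lambda>x. real (count_upto (H_pos_range r) x) / x) \<sim>[at_top]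
      (\<lambda>x. 3 / (2 * pi ^ 2) * (ln x) ^ 2 / x)"
    by (intro asymp_equiv_divide count asymp_equiv_refl)
  moreover have "((\<lambda>x. 3 / (2 * pi ^ 2) * (ln x) ^ 2 / x) \<longlongrightarrow> 0) at_top"
    by real_asymp
  ultimately show "natural_density_zero (H_pos_range r)"
    unfolding natural_density_zero_def by (simp only: tendsto_asymp_equiv_cong)
qed

end
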